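(* Let $\mathbb{F}$ be a field, $E$ a vector space over $\mathbb{F}$ with a symmetric bilinear form $b\colon E\times E\to\mathbb{F}$, and $\alpha\in\mathbb{F}$ with $\alpha\notin\{0,1\}$ and $\alpha\neq\frac12$ (i.e. $2\alpha\ne1$). The split spin factor algebra $A=S(b,\alpha)$ admits a Frobenius form $(\cdot,\cdot)$ given by $$(e,f)=(\alpha+1)(2-\alpha)b(e,f),\quad (e,z_1)=(e,z_2)=0,$$ $$(z_1,z_1)=\alpha+1,\quad (z_2,z_2)=2-\alpha,\quad (z_1,z_2)=0,$$ for all $e,f\in E$, extended bilinearly to $A$.
   Context: The split spin factor $S(b,\alpha)$ is the commutative (not necessarily associative) algebra on the vector space $E\oplus\mathbb{F}z_1\oplus\mathbb{F}z_2$ with multiplication $z_1^2=z_1$, $z_2^2=z_2$, $z_1z_2=0$, $ez_1=\alpha e$, $ez_2=(1-\alpha)e$, $ef=-b(e,f)z$ for all $e,f\in E$, where $z:=\alpha(\alpha-2)z_1+(\alpha-1)(\alpha+1)z_2$. A Frobenius form on an algebra $A$ is a non-zero symmetric bilinear form $(\cdot,\cdot)\colon A\times A\to\mathbb{F}$ with $(a,bc)=(ab,c)$ for all $a,b,c\in A$. *)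

theory Defs
  imports Complex_Main "HOL-Library.Product_Plus"
begin

definition bilinear_form :: "('f::field \<Rightarrow> 'v::ab_group_add \<Rightarrow> 'v) \<Rightarrow> ('v \<Rightarrow> 'v \<Rightarrow> 'f) \<Rightarrow> bool" where
  "bilinear_form scale B \<longleftrightarrow>
     (\<forall>x. Vector_Spaces.linear scale (*) (\<lambda>y. B x y)) \<and>
     (\<forall>y. Vector_Spaces.linear scale (*) (\<lambda>x. B x y))"

definition symmetric_bilinear_form :: "('f::field \<Rightarrow> 'v::ab_group_add \<Rightarrow> 'v) \<Rightarrow> ('v \<Rightarrow> 'v \<Rightarrow> 'f) \<Rightarrow> bool" where
  "symmetric_bilinear_form scale B \<longleftrightarrow> bilinear_form scale B \<and> (\<forall>x y. B x y = B y x)"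

definition frobenius_form ::
  "('f::field \<Rightarrow> 'v::ab_group_add \<Rightarrow> 'v) \<Rightarrow> ('v \<Rightarrow> 'v \<Rightarrow> 'v) \<Rightarrow> ('v \<Rightarrow> 'v \<Rightarrow> 'f) \<Rightarrow> bool" where
  "frobenius_form scale mult B \<longleftrightarrow>
     symmetric_bilinear_form scale B \<and>
     (\<exists>x y. B x y \<noteq> 0) \<and>
     (\<forall>x y z. B x (mult y z) = B (mult x y) z)"

text \<open>The vector space \<open>E \<oplus> F z\<^sub>1 \<oplus> F z\<^sub>2\<close> is encoded as \<open>'e \<times> 'f \<times> 'f\<close>:
  the triple \<open>(e, x, y)\<close> stands for \<open>e + x z\<^sub>1 + y z\<^sub>2\<close>. Addition is componentwise.\<close>

type_synonym ('e, 'f) ssf = "'e \<times> 'f \<times> 'f"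

definition ssf_scale :: "('f::field \<Rightarrow> 'e::ab_group_add \<Rightarrow> 'e) \<Rightarrow> 'f \<Rightarrow> ('e, 'f) ssf \<Rightarrow> ('e, 'f) ssf" where
  "ssf_scale scale c = (\<lambda>(e, x, y). (scale c e, c * x, c * y))"

definition ssf_E :: "'e::ab_group_add \<Rightarrow> ('e, 'f::field) ssf" where
  "ssf_E e = (e, 0, 0)"

definition ssf_z1 :: "('e::ab_group_add, 'f::field) ssf" where
  "ssf_z1 = (0, 1, 0)"

definition ssf_z2 :: "('e::ab_group_add, 'f::field) ssf" where
  "ssf_z2 = (0, 0, 1)"

definition ssf_z :: "('f::field \<Rightarrow> 'e::ab_group_add \<Rightarrow> 'e) \<Rightarrow> 'f \<Rightarrow> ('e, 'f) ssf" where
  "ssf_z scale \<alpha> =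
     ssf_scale scale (\<alpha> * (\<alpha> - 2)) ssf_z1 + ssf_scale scale ((\<alpha> - 1) * (\<alpha> + 1)) ssf_z2"

text \<open>The bilinear extension of the multiplication table of \<open>S(b, \<alpha>)\<close>; the table itself
  and bilinearity are \<open>ssf_mult_table\<close> and \<open>ssf_mult_linear_left\<close>, \<open>ssf_mult_linear_right\<close> below.\<close>

definition ssf_mult ::
  "('f::field \<Rightarrow> 'e::ab_group_add \<Rightarrow> 'e) \<Rightarrow> ('e \<Rightarrow> 'e \<Rightarrow> 'f) \<Rightarrow> 'f
     \<Rightarrow> ('e, 'f) ssf \<Rightarrow> ('e, 'f) ssf \<Rightarrow> ('e, 'f) ssf" where
  "ssf_mult scale b \<alpha> = (\<lambda>(e, x1, x2) (f, y1, y2).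
     ssf_E (scale (\<alpha> * y1 + (1 - \<alpha>) * y2) e + scale (\<alpha> * x1 + (1 - \<alpha>) * x2) f)
     + ssf_scale scale (x1 * y1) ssf_z1 + ssf_scale scale (x2 * y2) ssf_z2
     + ssf_scale scale (- b e f) (ssf_z scale \<alpha>))"

lemmas ssf_defs = ssf_scale_def ssf_E_def ssf_z1_def ssf_z2_def ssf_z_def ssf_mult_def

lemma ssf_decompose:
  assumes "vector_space scale"
  shows "(e, x, y) = ssf_E e + ssf_scale scale x ssf_z1 + ssf_scale scale y ssf_z2"
proof -
  interpret vector_space scale by fact
  show ?thesis by (simp add: ssf_defs)
qed

lemma vector_space_ssf_scale:
  assumes "vector_space scale"
  shows "vector_space (ssf_scale scale)"
proof -
  interpret vector_space scale by fact
  show ?thesis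
    by unfold_locales (auto simp: ssf_scale_def scale_right_distrib scale_left_distrib algebra_simps)
qed

lemma vector_space_field: "vector_space ((*) :: 'f::field \<Rightarrow> 'f \<Rightarrow> 'f)"
  by unfold_locales (auto simp: algebra_simps)

lemma bilinear_form_iff:
  assumes "vector_space scale"
  shows "bilinear_form scale B \<longleftrightarrow>
    (\<forall>x y z. B (x + y) z = B x z + B y z) \<and> (\<forall>x y z. B x (y + z) = B x y + B x z) \<and>
    (\<forall>c x y. B (scale c x) y = c * B x y) \<and> (\<forall>c x y. B x (scale c y) = c * B x y)"
  using assms vector_space_field
  unfolding bilinear_form_def Vector_Spaces.linear_iff by auto

lemma ssf_mult_table:
  assumes "vector_space scale" "symmetric_bilinear_form scale b"
  shows "ssf_mult scale b \<alpha> ssf_z1 ssf_z1 = ssf_z1"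
    and "ssf_mult scale b \<alpha> ssf_z2 ssf_z2 = ssf_z2"
    and "ssf_mult scale b \<alpha> ssf_z1 ssf_z2 = 0"
    and "ssf_mult scale b \<alpha> (ssf_E e) ssf_z1 = ssf_scale scale \<alpha> (ssf_E e)"
    and "ssf_mult scale b \<alpha> (ssf_E e) ssf_z2 = ssf_scale scale (1 - \<alpha>) (ssf_E e)"
    and "ssf_mult scale b \<alpha> (ssf_E e) (ssf_E f) = ssf_scale scale (- b e f) (ssf_z scale \<alpha>)"
proof -
  interpret vector_space scale by fact
  have b0: "b x 0 = 0" "b 0 x = 0" for x
    using assms(2) unfolding symmetric_bilinear_form_def bilinear_form_iff[OF assms(1)]
    by (metis mult_zero_left scale_zero_left)+
  show "ssf_mult scale b \<alpha> ssf_z1 ssf_z1 = ssf_z1"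
    "ssf_mult scale b \<alpha> ssf_z2 ssf_z2 = ssf_z2"
    "ssf_mult scale b \<alpha> ssf_z1 ssf_z2 = 0"
    "ssf_mult scale b \<alpha> (ssf_E e) ssf_z1 = ssf_scale scale \<alpha> (ssf_E e)"
    "ssf_mult scale b \<alpha> (ssf_E e) ssf_z2 = ssf_scale scale (1 - \<alpha>) (ssf_E e)"
    "ssf_mult scale b \<alpha> (ssf_E e) (ssf_E f) = ssf_scale scale (- b e f) (ssf_z scale \<alpha>)"
    by (auto simp: ssf_defs b0 zero_prod_def)
qed

lemma ssf_mult_commute:
  assumes "symmetric_bilinear_form scale b"
  shows "ssf_mult scale b \<alpha> u v = ssf_mult scale b \<alpha> v u"
  using assms
  by (auto simp: ssf_mult_def symmetric_bilinear_form_def add.commute mult.commute split: prod.splits)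

lemma ssf_mult_linear_left:
  assumes "vector_space scale" "symmetric_bilinear_form scale b"
  shows "Vector_Spaces.linear (ssf_scale scale) (ssf_scale scale) (\<lambda>u. ssf_mult scale b \<alpha> u v)"
proof -
  interpret vector_space scale by fact
  show ?thesis
    using assms vector_space_ssf_scale[OF assms(1)]
    unfolding Vector_Spaces.linear_iff symmetric_bilinear_form_def bilinear_form_iff[OF assms(1)]
    by (cases v) (auto simp: ssf_defs scale_right_distrib scale_left_distrib algebra_simps)
qed

lemma ssf_mult_linear_right:
  assumes "vector_space scale" "symmetric_bilinear_form scale b"
  shows "Vector_Spaces.linear (ssf_scale scale) (ssf_scale scale) (\<lambda>v. ssf_mult scale b \<alpha> u v)"
  using ssf_mult_linear_left[OF assms] by (simp add: ssf_mult_commute[OF assms(2), of _ u])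

end

theory Submission
  imports Defs
begin

text \<open>Let \<open>p (f, y\<^sub>1, y\<^sub>2) = \<alpha> y\<^sub>1 + (1 - \<alpha>) y\<^sub>2\<close>, the scalar by which the \<open>z\<^sub>1, z\<^sub>2\<close>-part of an element
  acts on \<open>E\<close>, and let \<open>k = (\<alpha> + 1) (2 - \<alpha>)\<close>. The coefficients of \<open>z\<close> are such that
  \<open>(z, x\<^sub>1 z\<^sub>1 + x\<^sub>2 z\<^sub>2) = - k (\<alpha> x\<^sub>1 + (1 - \<alpha>) x\<^sub>2)\<close>, so for elements \<open>u, v, w\<close> with \<open>E\<close>-components
  \<open>e, f, g\<close> the expression \<open>(u, v w)\<close> is the sum of multiples of the products of the \<open>z\<^sub>1\<close>-coordinates and of the
  \<open>z\<^sub>2\<close>-coordinates and of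
  \<open>k (p w b(e, f) + p v b(e, g) + p u b(f, g))\<close> (lemma \<open>ssf_form_mult\<close>). This is symmetric in \<open>u, v, w\<close>,
  and together with symmetry of the form it gives
  \<open>(u, v w) = (w, u v) = (u v, w)\<close>.

  The values \<open>(z\<^sub>1, z\<^sub>1)\<close> and \<open>(z\<^sub>2, z\<^sub>2)\<close> vanish simultaneously only if \<open>\<alpha> = -1\<close>
  and \<open>\<alpha> = 2\<close>; then \<open>3 = 0\<close> and \<open>2 \<alpha> = -2 = 1\<close>, which is excluded. Hence the form is non-zero.\<close>

text \<open>The bilinear extension of the prescribed values on \<open>E\<close>, \<open>z\<^sub>1\<close> and \<open>z\<^sub>2\<close>, for which the three
  summands are mutually orthogonal.\<close>

definition ssf_form ::
  "('e \<Rightarrow> 'e \<Rightarrow> 'f::field) \<Rightarrow> 'f \<Rightarrow> ('e, 'f) ssf \<Rightarrow> ('e, 'f) ssf \<Rightarrow> 'f" where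
  "ssf_form b \<alpha> = (\<lambda>(e, x1, x2) (f, y1, y2).
     (\<alpha> + 1) * (2 - \<alpha>) * b e f + (\<alpha> + 1) * (x1 * y1) + (2 - \<alpha>) * (x2 * y2))"

lemma symmetric_bilinear_form_ssf_form:
  assumes "vector_space scale" "symmetric_bilinear_form scale b"
  shows "symmetric_bilinear_form (ssf_scale scale) (ssf_form b \<alpha>)"
  using assms(2)
  unfolding symmetric_bilinear_form_def bilinear_form_iff[OF assms(1)]
    bilinear_form_iff[OF vector_space_ssf_scale[OF assms(1)]]
  by (auto simp: ssf_form_def ssf_scale_def algebra_simps)

lemma ssf_mult_components:
  assumes "vector_space scale"
  shows "ssf_mult scale b \<alpha> (f, y1, y2) (g, w1, w2) =
    (scale (\<alpha> * w1 + (1 - \<alpha>) * w2) f + scale (\<alpha> * y1 + (1 - \<alpha>) * y2) g,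
     y1 * w1 - b f g * (\<alpha> * (\<alpha> - 2)), y2 * w2 - b f g * ((\<alpha> - 1) * (\<alpha> + 1)))"
proof -
  interpret vector_space scale by fact
  show ?thesis by (simp add: ssf_defs)
qed

text \<open>The right-hand side does not change when \<open>u, v, w\<close> are permuted, because \<open>b\<close> is symmetric.\<close>

lemma ssf_form_mult:
  fixes \<alpha> :: "'f::field"
  assumes "vector_space scale" "symmetric_bilinear_form scale b"
    and "u = (e, x1, x2)" "v = (f, y1, y2)" "w = (g, w1, w2)"
  shows "ssf_form b \<alpha> u (ssf_mult scale b \<alpha> v w) =
    (\<alpha> + 1) * (2 - \<alpha>) * ((\<alpha> * w1 + (1 - \<alpha>) * w2) * b e f
      + (\<alpha> * y1 + (1 - \<alpha>) * y2) * b e g + (\<alpha> * x1 + (1 - \<alpha>) * x2) * b f g)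
    + (\<alpha> + 1) * (x1 * y1 * w1) + (2 - \<alpha>) * (x2 * y2 * w2)"
proof -
  have "b e (scale c f + scale d g) = c * b e f + d * b e g" for c d
    using assms(2) unfolding symmetric_bilinear_form_def bilinear_form_iff[OF assms(1)] by simp
  then show ?thesis
    unfolding assms(3-5) ssf_mult_components[OF assms(1)]
    by (simp add: ssf_form_def algebra_simps)
qed

lemma ssf_form_assoc:
  assumes "vector_space scale" "symmetric_bilinear_form scale b"
  shows "ssf_form b \<alpha> u (ssf_mult scale b \<alpha> v w) = ssf_form b \<alpha> (ssf_mult scale b \<alpha> u v) w"
proof -
  obtain e x1 x2 f y1 y2 g w1 w2
    where uvw: "u = (e, x1, x2)" "v = (f, y1, y2)" "w = (g, w1, w2)"
    by (metis prod.exhaust)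
  have b_sym: "b x y = b y x" for x y
    using assms(2) unfolding symmetric_bilinear_form_def by blast
  have "ssf_form b \<alpha> u (ssf_mult scale b \<alpha> v w) = ssf_form b \<alpha> w (ssf_mult scale b \<alpha> u v)"
    unfolding ssf_form_mult[OF assms uvw] ssf_form_mult[OF assms uvw(3,1,2)]
    by (simp add: b_sym[of g] ac_simps)
  also have "\<dots> = ssf_form b \<alpha> (ssf_mult scale b \<alpha> u v) w"
    using symmetric_bilinear_form_ssf_form[OF assms] unfolding symmetric_bilinear_form_def by blast
  finally show ?thesis .
qed

lemma ssf_form_values:
  assumes "vector_space scale" "symmetric_bilinear_form scale b"
  shows "ssf_form b \<alpha> (ssf_E e) (ssf_E f) = (\<alpha> + 1) * (2 - \<alpha>) * b e f"
    and "ssf_form b \<alpha> (ssf_E e) ssf_z1 = 0"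
    and "ssf_form b \<alpha> (ssf_E e) ssf_z2 = 0"
    and "ssf_form b \<alpha> ssf_z1 ssf_z1 = \<alpha> + 1"
    and "ssf_form b \<alpha> ssf_z2 ssf_z2 = 2 - \<alpha>"
    and "ssf_form b \<alpha> ssf_z1 ssf_z2 = 0"
proof -
  have "b x 0 = 0" for x
    using assms(2) unfolding symmetric_bilinear_form_def bilinear_form_iff[OF assms(1)]
    by (metis add_cancel_right_right)
  then show "ssf_form b \<alpha> (ssf_E e) (ssf_E f) = (\<alpha> + 1) * (2 - \<alpha>) * b e f"
    "ssf_form b \<alpha> (ssf_E e) ssf_z1 = 0"
    "ssf_form b \<alpha> (ssf_E e) ssf_z2 = 0"
    "ssf_form b \<alpha> ssf_z1 ssf_z1 = \<alpha> + 1"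
    "ssf_form b \<alpha> ssf_z2 ssf_z2 = 2 - \<alpha>"
    "ssf_form b \<alpha> ssf_z1 ssf_z2 = 0"
    by (simp_all add: ssf_form_def ssf_E_def ssf_z1_def ssf_z2_def)
qed

theorem theorem3p11:
  fixes scale :: "'f::field \<Rightarrow> 'e::ab_group_add \<Rightarrow> 'e"
    and b :: "'e \<Rightarrow> 'e \<Rightarrow> 'f"
    and \<alpha> :: 'f
  assumes "vector_space scale"
    and "symmetric_bilinear_form scale b"
    and "\<alpha> \<notin> {0, 1}"
    and "2 * \<alpha> \<noteq> 1"
  shows "\<exists>B :: ('e, 'f) ssf \<Rightarrow> ('e, 'f) ssf \<Rightarrow> 'f.
    frobenius_form (ssf_scale scale) (ssf_mult scale b \<alpha>) B \<and>
    (\<forall>e f. B (ssf_E e) (ssf_E f) = (\<alpha> + 1) * (2 - \<alpha>) * b e f) \<and>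
    (\<forall>e. B (ssf_E e) ssf_z1 = 0) \<and>
    (\<forall>e. B (ssf_E e) ssf_z2 = 0) \<and>
    B ssf_z1 ssf_z1 = \<alpha> + 1 \<and>
    B ssf_z2 ssf_z2 = 2 - \<alpha> \<and>
    B ssf_z1 ssf_z2 = 0"
proof -
  note vals = ssf_form_values[OF assms(1,2)]
  have "\<alpha> + 1 \<noteq> 0 \<or> 2 - \<alpha> \<noteq> 0"
  proof (rule ccontr)
    assume "\<not> ?thesis"
    then have "\<alpha> + 1 = 0" "2 - \<alpha> = 0" by auto
    moreover have "2 * \<alpha> - 1 = (\<alpha> + 1) - (2 - \<alpha>)" by (simp add: algebra_simps)
    ultimately have "2 * \<alpha> = 1" by (metis diff_self eq_iff_diff_eq_0)
    with assms(4) show False by contradiction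
  qed
  then have "\<exists>x y. ssf_form b \<alpha> x y \<noteq> 0"
    using vals(4,5) by metis
  then have "frobenius_form (ssf_scale scale) (ssf_mult scale b \<alpha>) (ssf_form b \<alpha>)"
    unfolding frobenius_form_def
    using symmetric_bilinear_form_ssf_form[OF assms(1,2)] ssf_form_assoc[OF assms(1,2)] by blast
  with vals show ?thesis by blast
qed

end
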